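(* For all $\alpha>0$, $C>0$ and $s_0\in(0,1]$ there exist $\varepsilon_0>0$ and $C'>0$ such that the following holds: if $\mathcal{S}$ is a local approximation class in $\mathbb{R}^n$ with an $(\alpha,C,s_0)$ covering profile and $A\subseteq\mathbb{R}^n$ is unilaterally $(\varepsilon,r_0)$-approximable by $\mathcal{S}$ for some $0<\varepsilon\leq\varepsilon_0$ and some $r_0>0$, then $$\overline{\dim}_M(A)\leq\alpha+\frac{C'}{\log(1/\varepsilon)}.$$
   Context: $B(x,r)$ denotes the closed ball in $\mathbb{R}^n$ with center $x$ and radius $r$. For $A,B\subseteq\mathbb{R}^n$ with $B\neq\emptyset$, the excess is $\mathrm{ex}(A,B)=\sup_{a\in A}\inf_{b\in B}|a-b|$, with $\mathrm{ex}(\emptyset,B)=0$. A local approximation class $\mathcal{S}$ is a nonempty collection of closed subsets of $\mathbb{R}^n$ containing $0$ such that $\lambda S\in\mathcal{S}$ for all $S\in\mathcal S$ and $\lambda>0$. Unilateral approximability: $\beta^{\mathcal S}_A(x,r)=\inf_{S\in\mathcal S}\frac1r\,\mathrm{ex}(A\cap B(x,r),x+S)$. $A$ is unilaterally $(\varepsilon,r_0)$-approximable by $\mathcal S$ if $\beta^{\mathcal S}_A(x,r)\leq\varepsilon$ for all $x\in A$ and $0<r\leq r_0$. Covering numbers: $N(A,s)$ is the least $k\geq0$ such that $A\subseteq\bigcup_{i=1}^kB(a_i,s)$ for some $a_i\in A$; and $N^{x,r}(A,s)=N(A\cap B(x,r),s)$. $\mathcal S$ has an $(\alpha,C,s_0)$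 covering profile if $N^{0,r}(S,sr)\leq Cs^{-\alpha}$ for all $S\in\mathcal S$, $r>0$ and $s\in(0,s_0]$. Upper Minkowski dimension: for bounded $A$, $\overline{\dim}_M(A)=\limsup_{s\downarrow0}\frac{\log N(A,s)}{\log(1/s)}$; for unbounded $A$, $\overline{\dim}_M(A)=\lim_{t\uparrow\infty}\overline{\dim}_M(A\cap B(0,t))$. (Convention $\overline{\dim}_M(\emptyset)=-\infty$.) *)

theory Defs
  imports "HOL-Analysis.Analysis"
begin

text \<open>
  The dimension \<open>n\<close> is quantified inside the theorem, after the constants, so \<open>\<real>\<^sup>n\<close> is
  the library's \<^const>\<open>Euclidean_space\<close> \<open>n\<close>, whose points are the sequences
  \<open>nat \<Rightarrow> real\<close> vanishing from index \<open>n\<close> on, rather than a type.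
\<close>

abbreviation Rn :: "nat \<Rightarrow> (nat \<Rightarrow> real) set" where
  "Rn n \<equiv> topspace (Euclidean_space n)"

abbreviation origin :: "nat \<Rightarrow> real" where
  "origin \<equiv> (\<lambda>i. 0)"

definition edist :: "nat \<Rightarrow> (nat \<Rightarrow> real) \<Rightarrow> (nat \<Rightarrow> real) \<Rightarrow> real" where
  "edist n x y = L2_set (\<lambda>i. x i - y i) {..<n}"

lemma Metric_space_edist: "Metric_space (Rn n) (edist n)"
proof
  fix x y z :: "nat \<Rightarrow> real"
  show "0 \<le> edist n x y"
    by (simp add: edist_def)
  show "edist n x y = edist n y x"
    by (simp add: edist_def L2_set_def power2_commute)
  show "edist n x y = 0 \<longleftrightarrow> x = y" if "x \<in> Rn n" "y \<in> Rn n"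
  proof
    assume "edist n x y = 0"
    then have "x i = y i" for i
      using that by (cases "i < n") (auto simp: edist_def L2_set_eq_0_iff topspace_Euclidean_space)
    then show "x = y" by blast
  qed (simp add: edist_def L2_set_def)
  show "edist n x z \<le> edist n x y + edist n y z"
    using L2_set_triangle_ineq[of "\<lambda>i. x i - y i" "\<lambda>i. y i - z i" "{..<n}"]
    by (simp add: edist_def)
qed

text \<open>The metric induces the topology in which closed sets are taken below.\<close>

lemma mtopology_edist: "Metric_space.mtopology (Rn n) (edist n) = Euclidean_space n"
proof -
  interpret M: Metric_space "Rn n" "edist n" by (rule Metric_space_edist)
  have coord: "\<bar>x i - y i\<bar> \<le> edist n x y" if "x \<in> Rn n" "y \<in> Rn n" for x y i
  proof (cases "i < n")
    case True
    then show ?thesis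
      using member_le_L2_set[of "{..<n}" i "\<lambda>i. \<bar>x i - y i\<bar>"]
      by (simp add: edist_def L2_set_def)
  qed (use that in \<open>auto simp: topspace_Euclidean_space edist_def\<close>)
  have "continuous_map M.mtopology euclideanreal (\<lambda>x. x i)" for i
  proof -
    have "openin M.mtopology {x \<in> Rn n. x i \<in> U}" if "open U" for U
      unfolding M.openin_mtopology
    proof (intro conjI allI impI)
      fix x assume x: "x \<in> {x \<in> Rn n. x i \<in> U}"
      then obtain e where "e > 0" and e: "\<And>t. \<bar>t - x i\<bar> < e \<Longrightarrow> t \<in> U"
        using \<open>open U\<close> by (auto simp: open_dist dist_real_def)
      have "M.mball x e \<subseteq> {x \<in> Rn n. x i \<in> U}"
      proof
        fix y assume "y \<in> M.mball x e"
        then show "y \<in> {x \<in> Rn n. x i \<in> U}"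
          using coord[of x y i] e[of "y i"] by auto
      qed
      with \<open>e > 0\<close> show "\<exists>r>0. M.mball x r \<subseteq> {x \<in> Rn n. x i \<in> U}" by blast
    qed auto
    then show ?thesis by (simp add: continuous_map_def)
  qed
  then have pow: "continuous_map M.mtopology (powertop_real UNIV) (\<lambda>x. x)"
    by (simp add: continuous_map_componentwise_UNIV)
  have sub: "continuous_map X (Euclidean_space n) f"
    if "continuous_map X (powertop_real UNIV) f" "f \<in> topspace X \<rightarrow> {x. \<forall>i\<ge>n. x i = 0}"
    for X :: "(nat \<Rightarrow> real) topology" and f
    using that by (simp add: Euclidean_space_def continuous_map_in_subtopology)
  have id: "continuous_map M.mtopology (Euclidean_space n) (\<lambda>x. x)"
  proof -
    have "(\<lambda>x. x) \<in> topspace M.mtopology \<rightarrow> {x. \<forall>i\<ge>n. x i = 0}"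
      unfolding M.topspace_mtopology unfolding topspace_Euclidean_space by simp
    then show ?thesis by (rule sub[OF pow])
  qed
  show ?thesis
    unfolding topology_eq
  proof (intro allI iffI)
    fix U assume "openin (Euclidean_space n) U"
    with id show "openin M.mtopology U"
      using openin_subset[of "Euclidean_space n" U]
      by (auto simp: continuous_map_def Int_absorb1 Collect_conj_eq Collect_mem_eq)
  next
    fix U assume U: "openin M.mtopology U"
    show "openin (Euclidean_space n) U"
      unfolding openin_subopen[of _ U]
    proof
      fix x assume "x \<in> U"
      with U obtain e where e: "e > 0" "M.mball x e \<subseteq> U" and x: "x \<in> Rn n"
        unfolding M.openin_mtopology by blast
      define V where "V = {y \<in> Rn n. edist n x y \<in> {..<e}}"
      have "continuous_map (Euclidean_space n) euclideanreal (\<lambda>y. y i)" for i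
        unfolding Euclidean_space_def
        by (intro continuous_map_from_subtopology continuous_map_product_coordinates UNIV_I)
      then have "continuous_map (Euclidean_space n) euclideanreal (edist n x)"
        unfolding edist_def L2_set_def by (intro continuous_intros) auto
      then have "openin (Euclidean_space n) V"
        unfolding V_def by (rule openin_continuous_map_preimage) simp
      moreover have "x \<in> V" "V \<subseteq> U"
        using e x by (auto simp: V_def subset_iff)
      ultimately show "\<exists>T. openin (Euclidean_space n) T \<and> x \<in> T \<and> T \<subseteq> U" by blast
    qed
  qed
qed

abbreviation ecball :: "nat \<Rightarrow> (nat \<Rightarrow> real) \<Rightarrow> real \<Rightarrow> (nat \<Rightarrow> real) set" where
  "ecball n \<equiv> Metric_space.mcball (Rn n) (edist n)"

abbreviation ebounded :: "nat \<Rightarrow> (nat \<Rightarrow> real) set \<Rightarrow> bool" where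
  "ebounded n \<equiv> Metric_space.mbounded (Rn n) (edist n)"

definition translate_set :: "(nat \<Rightarrow> real) \<Rightarrow> (nat \<Rightarrow> real) set \<Rightarrow> (nat \<Rightarrow> real) set" where
  "translate_set x S = (\<lambda>v i. x i + v i) ` S"

definition dilate_set :: "real \<Rightarrow> (nat \<Rightarrow> real) set \<Rightarrow> (nat \<Rightarrow> real) set" where
  "dilate_set c S = (\<lambda>v i. c * v i) ` S"

text \<open>Values in \<^typ>\<open>ennreal\<close> make the supremum over the empty set \<open>0\<close>, as required.\<close>

definition excess :: "nat \<Rightarrow> (nat \<Rightarrow> real) set \<Rightarrow> (nat \<Rightarrow> real) set \<Rightarrow> ennreal" where
  "excess n A B = (SUP a\<in>A. INF b\<in>B. ennreal (edist n a b))"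

definition local_approximation_class :: "nat \<Rightarrow> (nat \<Rightarrow> real) set set \<Rightarrow> bool" where
  "local_approximation_class n \<S> \<longleftrightarrow>
     \<S> \<noteq> {} \<and>
     (\<forall>S\<in>\<S>. closedin (Euclidean_space n) S \<and> origin \<in> S) \<and>
     (\<forall>S\<in>\<S>. \<forall>c>0. dilate_set c S \<in> \<S>)"

definition unilateral_beta ::
    "nat \<Rightarrow> (nat \<Rightarrow> real) set set \<Rightarrow> (nat \<Rightarrow> real) set \<Rightarrow> (nat \<Rightarrow> real) \<Rightarrow> real \<Rightarrow> ennreal" where
  "unilateral_beta n \<S> A x r =
     (INF S\<in>\<S>. excess n (A \<inter> ecball n x r) (translate_set x S) / ennreal r)"

definition unilaterally_approximable ::
    "nat \<Rightarrow> (nat \<Rightarrow> real) set set \<Rightarrow> real \<Rightarrow> real \<Rightarrow> (nat \<Rightarrow> real) set \<Rightarrow> bool" where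
  "unilaterally_approximable n \<S> \<epsilon> r\<^sub>0 A \<longleftrightarrow>
     (\<forall>x\<in>A. \<forall>r. 0 < r \<and> r \<le> r\<^sub>0 \<longrightarrow> unilateral_beta n \<S> A x r \<le> ennreal \<epsilon>)"

text \<open>The value is \<open>\<infinity>\<close> if no finite cover by such balls exists.\<close>

definition covering_number :: "nat \<Rightarrow> (nat \<Rightarrow> real) set \<Rightarrow> real \<Rightarrow> enat" where
  "covering_number n A s =
     (INF k\<in>{k. \<exists>a. (\<forall>i\<in>{1..k}. a i \<in> A) \<and> A \<subseteq> (\<Union>i\<in>{1..k}. ecball n (a i) s)}. enat k)"

definition covering_profile ::
    "nat \<Rightarrow> (nat \<Rightarrow> real) set set \<Rightarrow> real \<Rightarrow> real \<Rightarrow> real \<Rightarrow> bool" where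
  "covering_profile n \<S> \<alpha> C s\<^sub>0 \<longleftrightarrow>
     (\<forall>S\<in>\<S>. \<forall>r>0. \<forall>s. 0 < s \<and> s \<le> s\<^sub>0 \<longrightarrow>
        ereal_of_enat (covering_number n (S \<inter> ecball n origin r) (s * r))
          \<le> ereal (C * s powr (- \<alpha>)))"

text \<open>
  With \<open>log 0 = -\<infinity>\<close>, the upper Minkowski dimension of the empty set is \<open>-\<infinity>\<close>
  without a special case.
\<close>

definition log_enat :: "enat \<Rightarrow> ereal" where
  "log_enat k = (case k of enat m \<Rightarrow> if m = 0 then -\<infinity> else ereal (ln (real m)) | \<infinity> \<Rightarrow> \<infinity>)"

definition bounded_upper_Minkowski_dim :: "nat \<Rightarrow> (nat \<Rightarrow> real) set \<Rightarrow> ereal" where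
  "bounded_upper_Minkowski_dim n A =
     Limsup (at_right 0) (\<lambda>s. log_enat (covering_number n A s) / ereal (ln (1 / s)))"

definition upper_Minkowski_dim :: "nat \<Rightarrow> (nat \<Rightarrow> real) set \<Rightarrow> ereal" where
  "upper_Minkowski_dim n A =
     (if ebounded n A then bounded_upper_Minkowski_dim n A
      else Lim at_top (\<lambda>t. bounded_upper_Minkowski_dim n (A \<inter> ecball n origin t)))"

lemma upper_Minkowski_dim_empty: "upper_Minkowski_dim n {} = -\<infinity>"
proof -
  interpret M: Metric_space "Rn n" "edist n" by (rule Metric_space_edist)
  have "covering_number n {} s \<le> enat 0" for s
    unfolding covering_number_def by (rule INF_lower) simp
  then have "covering_number n {} s = 0" for s
    by (simp flip: zero_enat_def)
  then have "\<forall>\<^sub>F s in at_right 0.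
      log_enat (covering_number n {} s) / ereal (ln (1 / s)) = -\<infinity>"
    unfolding eventually_at_right_field
    by (intro exI[of _ 1]) (auto simp: log_enat_def zero_enat_def ln_div)
  then have "bounded_upper_Minkowski_dim n {} = Limsup (at_right (0::real)) (\<lambda>s. -\<infinity>)"
    unfolding bounded_upper_Minkowski_dim_def by (rule Limsup_eq)
  then show ?thesis
    by (simp add: upper_Minkowski_dim_def Limsup_const)
qed

end

theory Submission
  imports Defs
begin

text \<open>
  Around a point \<open>x\<close> of \<open>A\<close> and at a scale \<open>r \<le> r\<^sub>0\<close>, the part of \<open>A\<close> in the
  ball of radius \<open>r\<close> about \<open>x\<close> lies in the
  \<open>2\<epsilon>r\<close>-neighbourhood of some translate \<open>x + S\<close>, and the covering profile at relative scale
  \<open>\<epsilon>\<close> covers the relevant part of \<open>S\<close> by at most \<open>M = C \<epsilon>\<^bsup>-\<alpha>\<^esup>\<close> balls whose radii are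
  comparable to \<open>\<epsilon>r\<close>. After moving the centres into \<open>A\<close>, the piece of \<open>A\<close> in any ball of
  radius \<open>r\<close> centred on \<open>A\<close> is covered by \<open>M\<close> balls of radius \<open>8\<epsilon>r\<close>, again centred on \<open>A\<close>
  (\<open>approximable_piece_net\<close>).

  The new centres lie in \<open>A\<close>, so the estimate applies to each of the smaller balls. If \<open>A\<close> is
  bounded, it is covered by some finite number \<open>K\<close> of balls of radius \<open>r\<^sub>0\<close>, hence by \<open>K M\<^sup>m\<close>
  balls of radius \<open>(8\<epsilon>)\<^sup>m r\<^sub>0\<close> (\<open>iterated_net\<close>). Interpolating between these scales bounds
  the upper Minkowski dimension by
  \<open>ln M / ln (1 / (8\<epsilon>)) = \<alpha> + (ln C + \<alpha> ln 8) / (ln (1/\<epsilon>) - ln 8)\<close>. For \<open>\<epsilon> \<le> 1/64\<close> the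
  denominator is at least half of \<open>ln (1/\<epsilon>)\<close>, which gives \<open>C' = 2 (\<bar>ln C\<bar> + \<alpha> ln 8)\<close>.

  An unbounded \<open>A\<close> reduces to its bounded pieces: they inherit approximability, and the
  dimension is monotone (\<open>bounded_upper_Minkowski_dim_mono\<close>), so the limit that defines the
  dimension of \<open>A\<close> exists and is the supremum over the pieces.
\<close>

section \<open>Nets and covering numbers\<close>

definition ball_net :: "nat \<Rightarrow> (nat \<Rightarrow> real) set \<Rightarrow> real \<Rightarrow> (nat \<Rightarrow> real) set \<Rightarrow> bool" where
  "ball_net n A s F \<longleftrightarrow> finite F \<and> F \<subseteq> A \<and> A \<subseteq> (\<Union>x\<in>F. ecball n x s)"

lemma mem_ecball: "y \<in> ecball n x r \<longleftrightarrow> x \<in> Rn n \<and> y \<in> Rn n \<and> edist n x y \<le> r"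
  using Metric_space.in_mcball[OF Metric_space_edist] by blast

lemma edist_nonneg: "0 \<le> edist n x y"
  by (simp add: edist_def)

lemma edist_commute: "edist n x y = edist n y x"
  by (simp add: edist_def L2_set_def power2_commute)

lemma edist_triangle: "edist n x z \<le> edist n x y + edist n y z"
  using L2_set_triangle_ineq[of "\<lambda>i. x i - y i" "\<lambda>i. y i - z i" "{..<n}"]
  by (simp add: edist_def)

lemma edist_translate: "edist n (\<lambda>i. x i + u i) (\<lambda>i. x i + v i) = edist n u v"
  by (simp add: edist_def)

lemma covering_number_le_iff:
  "covering_number n A s \<le> enat k \<longleftrightarrow> (\<exists>F. ball_net n A s F \<and> card F \<le> k)"
proof
  assume "covering_number n A s \<le> enat k"
  then have "covering_number n A s < enat (Suc k)"
    by (rule order.strict_trans1) simp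
  then obtain j a where j: "j \<le> k" and a: "\<forall>i\<in>{1..j}. a i \<in> A"
      "A \<subseteq> (\<Union>i\<in>{1..j}. ecball n (a i) s)"
    unfolding covering_number_def INF_less_iff by (auto simp: less_Suc_eq_le)
  have "card (a ` {1..j}) \<le> k"
    using card_image_le[of "{1..j}" a] j by simp
  moreover have "ball_net n A s (a ` {1..j})"
    using a unfolding ball_net_def by auto
  ultimately show "\<exists>F. ball_net n A s F \<and> card F \<le> k" by blast
next
  assume "\<exists>F. ball_net n A s F \<and> card F \<le> k"
  then obtain F where F: "ball_net n A s F" "card F \<le> k" by blast
  then obtain a where a: "bij_betw a {1..card F} F"
    using ex_bij_betw_nat_finite_1[of F] unfolding ball_net_def by blast
  have "covering_number n A s \<le> enat (card F)"
    unfolding covering_number_def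
  proof (rule INF_lower, intro CollectI exI conjI)
    show "\<forall>i\<in>{1..card F}. a i \<in> A"
      using a F(1) unfolding ball_net_def bij_betw_def by blast
    have "(\<Union>i\<in>{1..card F}. ecball n (a i) s) = (\<Union>x\<in>a ` {1..card F}. ecball n x s)"
      by (simp only: image_image)
    then show "A \<subseteq> (\<Union>i\<in>{1..card F}. ecball n (a i) s)"
      using F(1) by (simp only: bij_betw_imp_surj_on[OF a] ball_net_def)
  qed
  with F(2) show "covering_number n A s \<le> enat k"
    by (meson enat_ord_simps(1) order_trans)
qed

lemma ereal_covering_number_le_iff:
  "ereal_of_enat (covering_number n A s) \<le> ereal b
    \<longleftrightarrow> (\<exists>F. ball_net n A s F \<and> real (card F) \<le> b)"
proof
  assume le: "ereal_of_enat (covering_number n A s) \<le> ereal b"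
  then obtain k where k: "covering_number n A s = enat k"
    by (cases "covering_number n A s") auto
  with covering_number_le_iff[of n A s k] obtain F where "ball_net n A s F" "card F \<le> k"
    by auto
  moreover from le k have "real k \<le> b" by simp
  ultimately show "\<exists>F. ball_net n A s F \<and> real (card F) \<le> b"
    by (meson of_nat_mono order_trans)
next
  assume "\<exists>F. ball_net n A s F \<and> real (card F) \<le> b"
  then obtain F where F: "ball_net n A s F" "real (card F) \<le> b" by blast
  then have "covering_number n A s \<le> enat (card F)"
    using covering_number_le_iff by blast
  then obtain k where "covering_number n A s = enat k" "k \<le> card F"
    by (cases "covering_number n A s") auto
  with F(2) show "ereal_of_enat (covering_number n A s) \<le> ereal b" by simp
qed

text \<open>
  Centres that lie off the set can be moved into it at the price of doubling the radius: each
  centre is replaced by a point of \<open>A\<close> assigned to it.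
\<close>

lemma ball_net_recentre:
  assumes A: "A \<subseteq> Rn n" and P: "finite P"
    and near: "\<And>a. a \<in> A \<Longrightarrow> \<exists>p\<in>P. edist n a p \<le> \<delta>"
  shows "\<exists>F. ball_net n A (2 * \<delta>) F \<and> card F \<le> card P"
proof -
  from near obtain f where f: "\<And>a. a \<in> A \<Longrightarrow> f a \<in> P \<and> edist n a (f a) \<le> \<delta>"
    by metis
  define F where "F = inv_into A f ` (f ` A)"
  have sub: "f ` A \<subseteq> P" using f by blast
  with P have fin: "finite (f ` A)" by (rule finite_subset[rotated])
  have "A \<subseteq> (\<Union>x\<in>F. ecball n x (2 * \<delta>))"
  proof
    fix a assume a: "a \<in> A"
    define b where "b = inv_into A f (f a)"
    have b: "b \<in> A" "f b = f a"
      using a by (auto simp: b_def inv_into_into f_inv_into_f)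
    have "edist n b a \<le> edist n b (f a) + edist n (f a) a" by (rule edist_triangle)
    also have "\<dots> \<le> \<delta> + \<delta>"
      using f[OF a] f[OF b(1)] b(2) by (intro add_mono) (auto simp: edist_commute)
    finally have "edist n b a \<le> 2 * \<delta>" by simp
    moreover have "b \<in> F" using a by (auto simp: F_def b_def)
    ultimately show "a \<in> (\<Union>x\<in>F. ecball n x (2 * \<delta>))"
      using A a b(1) unfolding UN_iff mem_ecball by blast
  qed
  moreover have "F \<subseteq> A" by (auto simp: F_def inv_into_into)
  moreover have "card F \<le> card P"
    unfolding F_def using card_image_le[OF fin] card_mono[OF P sub] by (meson order_trans)
  ultimately show ?thesis
    using fin unfolding ball_net_def F_def by blast
qed

text \<open>
  Rounding the coordinates down to multiples of \<open>\<delta>\<close> maps a bounded set to finitely many grid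
  points and moves each point by at most \<open>n\<delta>\<close>.
\<close>

lemma bounded_ball_net:
  assumes A: "ebounded n A" and r: "0 < r"
  shows "\<exists>F. ball_net n A r F"
proof -
  interpret M: Metric_space "Rn n" "edist n" by (rule Metric_space_edist)
  from A obtain c R where cR: "A \<subseteq> ecball n c R" unfolding M.mbounded_def by blast
  define \<delta> where "\<delta> = r / (2 * (real n + 1))"
  have \<delta>: "0 < \<delta>" using r by (simp add: \<delta>_def)
  define B where "B = (\<Union>i<n. {\<lfloor>(c i - R) / \<delta>\<rfloor>..\<lfloor>(c i + R) / \<delta>\<rfloor>})"
  define P where "P = {f. \<forall>i. (i \<in> {..<n} \<longrightarrow> f i \<in> (\<lambda>k. \<delta> * of_int k) ` B) \<and>
                              (i \<notin> {..<n} \<longrightarrow> f i = (0::real))}"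
  have "finite P"
    unfolding P_def B_def by (rule finite_set_of_finite_funs) auto
  have "\<exists>p\<in>P. edist n a p \<le> r / 2" if a: "a \<in> A" for a
  proof -
    define p where "p = (\<lambda>i. if i < n then \<delta> * of_int \<lfloor>a i / \<delta>\<rfloor> else 0)"
    have "\<lfloor>a i / \<delta>\<rfloor> \<in> B" if i: "i < n" for i
    proof -
      have "\<bar>c i - a i\<bar> \<le> edist n c a"
        using member_le_L2_set[of "{..<n}" i "\<lambda>i. \<bar>c i - a i\<bar>"] i
        by (simp add: edist_def L2_set_def)
      also have "\<dots> \<le> R" using a cR by (auto simp: mem_ecball)
      finally have "c i - R \<le> a i" "a i \<le> c i + R" by auto
      then have "\<lfloor>(c i - R) / \<delta>\<rfloor> \<le> \<lfloor>a i / \<delta>\<rfloor>" "\<lfloor>a i / \<delta>\<rfloor> \<le> \<lfloor>(c i + R) / \<delta>\<rfloor>"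
        using \<delta> by (auto intro!: floor_mono divide_right_mono)
      then show ?thesis using i unfolding B_def by auto
    qed
    then have "p \<in> P" by (auto simp: P_def p_def)
    moreover have "edist n a p \<le> (\<Sum>i<n. \<bar>a i - p i\<bar>)"
      unfolding edist_def by (rule L2_set_le_sum_abs)
    moreover have "(\<Sum>i<n. \<bar>a i - p i\<bar>) \<le> (\<Sum>i<n. \<delta>)"
    proof (rule sum_mono)
      fix i assume i: "i \<in> {..<n}"
      define k where "k = real_of_int \<lfloor>a i / \<delta>\<rfloor>"
      have "k \<le> a i / \<delta>" "a i / \<delta> \<le> k + 1"
        unfolding k_def by linarith+
      then have "\<delta> * of_int \<lfloor>a i / \<delta>\<rfloor> \<le> a i" "a i \<le> \<delta> * of_int \<lfloor>a i / \<delta>\<rfloor> + \<delta>"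
        using \<delta> unfolding k_def[symmetric] by (auto simp: field_simps)
      with i show "\<bar>a i - p i\<bar> \<le> \<delta>" by (auto simp: p_def)
    qed
    moreover have "(\<Sum>i<n. \<delta>) \<le> r / 2"
      using r by (simp add: \<delta>_def field_simps)
    ultimately show ?thesis by force
  qed
  moreover have "A \<subseteq> Rn n" using cR M.mcball_subset_mspace by blast
  ultimately show ?thesis
    using ball_net_recentre[OF _ \<open>finite P\<close>, of A n "r / 2"] by auto
qed

section \<open>Upper Minkowski dimension as a growth exponent\<close>

lemma bounded_upper_Minkowski_dim_leI:
  assumes "0 < B"
    and ev: "\<forall>\<^sub>F s in at_right 0.
      ereal_of_enat (covering_number n A s) \<le> ereal (B * s powr (- d))"
  shows "bounded_upper_Minkowski_dim n A \<le> ereal d"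
proof -
  have small: "\<forall>\<^sub>F s in at_right (0::real). 0 < s \<and> s < 1"
    unfolding eventually_at_right_field by (intro exI[of _ 1]) auto
  have "filterlim (\<lambda>s::real. ln (1 / s)) at_top (at_right 0)"
    by (simp add: divide_inverse)
       (rule filterlim_compose[OF ln_at_top filterlim_inverse_at_top_right])
  then have "((\<lambda>s::real. ln B / ln (1 / s) + d) \<longlongrightarrow> 0 + d) (at_right 0)"
    by (intro tendsto_add tendsto_const real_tendsto_divide_at_top[OF tendsto_const])
  then have lim: "((\<lambda>s::real. ereal (ln B / ln (1 / s) + d)) \<longlongrightarrow> ereal d) (at_right 0)"
    by simp
  have "\<forall>\<^sub>F s in at_right (0::real).
      log_enat (covering_number n A s) / ereal (ln (1 / s)) \<le> ereal (ln B / ln (1 / s) + d)"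
    using ev small
  proof eventually_elim
    case (elim s)
    then obtain k where k: "covering_number n A s = enat k" "real k \<le> B * s powr (- d)"
      by (cases "covering_number n A s") auto
    have pos: "0 < ln (1 / s)" using elim by (simp add: ln_div)
    show ?case
    proof (cases "k = 0")
      case True
      with k pos show ?thesis by (simp add: log_enat_def)
    next
      case False
      have "ln (real k) \<le> ln (B * s powr (- d))"
        using False k(2) elim \<open>0 < B\<close> by (subst ln_le_cancel_iff) auto
      also have "\<dots> = ln B + d * ln (1 / s)"
        using elim \<open>0 < B\<close> by (simp add: ln_mult ln_powr ln_div)
      finally have "ln (real k) / ln (1 / s) \<le> (ln B + d * ln (1 / s)) / ln (1 / s)"
        using pos by (intro divide_right_mono) auto
      also have "\<dots> = ln B / ln (1 / s) + d"
        using pos by (simp add: add_divide_distrib)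
      finally show ?thesis
        using False k(1) pos by (simp add: log_enat_def)
    qed
  qed
  then have "bounded_upper_Minkowski_dim n A
      \<le> Limsup (at_right 0) (\<lambda>s::real. ereal (ln B / ln (1 / s) + d))"
    unfolding bounded_upper_Minkowski_dim_def by (rule Limsup_mono)
  also have "\<dots> = ereal d"
    using lim by (intro lim_imp_Limsup) simp
  finally show ?thesis .
qed

lemma bounded_upper_Minkowski_dim_lessD:
  assumes "bounded_upper_Minkowski_dim n A < ereal d"
  shows "\<forall>\<^sub>F s in at_right 0. ereal_of_enat (covering_number n A s) \<le> ereal (s powr (- d))"
proof -
  have small: "\<forall>\<^sub>F s in at_right (0::real). 0 < s \<and> s < 1"
    unfolding eventually_at_right_field by (intro exI[of _ 1]) auto
  have "\<forall>\<^sub>F s in at_right 0.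
      log_enat (covering_number n A s) / ereal (ln (1 / s)) < ereal d"
    using assms unfolding bounded_upper_Minkowski_dim_def by (rule Limsup_lessD)
  then show ?thesis using small
  proof eventually_elim
    case (elim s)
    have pos: "0 < ln (1 / s)" using elim by (simp add: ln_div)
    obtain k where k: "covering_number n A s = enat k"
      using elim(1) pos by (cases "covering_number n A s") (auto simp: log_enat_def)
    show ?case
    proof (cases "k = 0")
      case False
      then have "ln (real k) / ln (1 / s) < d"
        using elim(1) k pos by (simp add: log_enat_def)
      then have "ln (real k) < ln (s powr (- d))"
        using pos elim(2) by (simp add: field_simps ln_powr ln_div)
      then have "real k < s powr (- d)"
        using False elim(2) by (subst (asm) ln_less_cancel_iff) auto
      then show ?thesis using k by simp
    qed (simp add: k)
  qed
qed

text \<open>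
  Centres must lie in the set being covered, so covering numbers themselves are not monotone;
  passing from \<open>B\<close> to a subset doubles the radius, which the growth exponent does not see.
\<close>

lemma bounded_upper_Minkowski_dim_mono:
  assumes "A \<subseteq> B" "B \<subseteq> Rn n"
  shows "bounded_upper_Minkowski_dim n A \<le> bounded_upper_Minkowski_dim n B"
proof (rule ereal_le_real)
  fix d assume le: "bounded_upper_Minkowski_dim n B \<le> ereal d"
  have step: "bounded_upper_Minkowski_dim n A \<le> ereal e" if "d < e" for e
  proof (rule bounded_upper_Minkowski_dim_leI)
    show "0 < (1 / 2) powr (- e)" by simp
    have "bounded_upper_Minkowski_dim n B < ereal e"
      using le that by (simp add: order.strict_trans1)
    then have "\<forall>\<^sub>F s in at_right 0.
        ereal_of_enat (covering_number n B s) \<le> ereal (s powr (- e))"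
      by (rule bounded_upper_Minkowski_dim_lessD)
    moreover have "filterlim (\<lambda>s::real. s / 2) (at_right 0) (at_right 0)"
      unfolding filterlim_at
      by (auto intro!: tendsto_eq_intros simp: eventually_at_right_field intro: exI[of _ 1])
    ultimately have "\<forall>\<^sub>F s in at_right 0.
        ereal_of_enat (covering_number n B (s / 2)) \<le> ereal ((s / 2) powr (- e))"
      by (rule eventually_compose_filterlim)
    moreover have "\<forall>\<^sub>F s in at_right (0::real). 0 < s"
      by (simp add: eventually_at_right_less)
    ultimately show "\<forall>\<^sub>F s in at_right 0.
        ereal_of_enat (covering_number n A s) \<le> ereal ((1 / 2) powr (- e) * s powr (- e))"
    proof eventually_elim
      case (elim s)
      then obtain F where F: "ball_net n B (s / 2) F" "real (card F) \<le> (s / 2) powr (- e)"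
        unfolding ereal_covering_number_le_iff by blast
      have "\<exists>p\<in>F. edist n a p \<le> s / 2" if "a \<in> A" for a
      proof -
        from that assms(1) F(1) obtain p where "p \<in> F" "a \<in> ecball n p (s / 2)"
          unfolding ball_net_def by blast
        then show ?thesis by (auto simp: mem_ecball edist_commute)
      qed
      moreover have "A \<subseteq> Rn n" using assms by blast
      moreover have "finite F" using F(1) by (simp add: ball_net_def)
      ultimately obtain G where G: "ball_net n A s G" "card G \<le> card F"
        using ball_net_recentre[of A n F "s / 2"] by auto
      have "(s / 2) powr (- e) = (1 / 2) powr (- e) * s powr (- e)"
        using elim(2) powr_mult[of "1 / 2" s "- e"] by simp
      with G F(2) show ?case
        unfolding ereal_covering_number_le_iff by (intro exI[of _ G]) auto
    qed
  qed
  show "bounded_upper_Minkowski_dim n A \<le> ereal d"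
  proof (rule ereal_le_epsilon2)
    fix e :: real assume "0 < e"
    then show "bounded_upper_Minkowski_dim n A \<le> ereal d + ereal e"
      using step[of "d + e"] by simp
  qed
qed

text \<open>
  Monotonicity makes the defining limit for an unbounded set exist; without existence its value
  would be unspecified.
\<close>

lemma upper_Minkowski_dim_leI:
  assumes A: "A \<subseteq> Rn n"
    and bound: "\<And>A'. \<lbrakk>A' \<subseteq> A; ebounded n A'\<rbrakk> \<Longrightarrow> bounded_upper_Minkowski_dim n A' \<le> b"
  shows "upper_Minkowski_dim n A \<le> b"
proof (cases "ebounded n A")
  case True
  then show ?thesis using bound by (simp add: upper_Minkowski_dim_def)
next
  case False
  interpret M: Metric_space "Rn n" "edist n" by (rule Metric_space_edist)
  let ?f = "\<lambda>t. bounded_upper_Minkowski_dim n (A \<inter> ecball n origin t)"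
  have mono: "?f t \<le> ?f u" if "t \<le> u" for t u
    using that A by (intro bounded_upper_Minkowski_dim_mono) (auto simp: mem_ecball)
  have "(?f \<longlongrightarrow> (SUP t. ?f t)) at_top"
  proof (rule increasing_tendsto)
    show "\<forall>\<^sub>F t in at_top. ?f t \<le> (SUP t. ?f t)"
      by (intro always_eventually allI SUP_upper) simp
    fix x assume "x < (SUP t. ?f t)"
    then obtain t where "x < ?f t" by (auto simp: less_SUP_iff)
    then show "\<forall>\<^sub>F u in at_top. x < ?f u"
      using mono by (intro eventually_at_top_linorderI[of t]) (meson less_le_trans)
  qed
  then have "upper_Minkowski_dim n A = (SUP t. ?f t)"
    using False by (simp add: upper_Minkowski_dim_def tendsto_Lim)
  also have "\<dots> \<le> b"
  proof (rule SUP_least)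
    fix t
    have "ebounded n (A \<inter> ecball n origin t)"
      unfolding M.mbounded_def by blast
    then show "?f t \<le> b" by (rule bound[rotated]) blast
  qed
  finally show ?thesis .
qed

section \<open>From one scale to all scales\<close>

lemma unilaterally_approximable_subset:
  assumes "unilaterally_approximable n \<S> \<epsilon> r\<^sub>0 A" "A' \<subseteq> A"
  shows "unilaterally_approximable n \<S> \<epsilon> r\<^sub>0 A'"
  unfolding unilaterally_approximable_def
proof (intro ballI allI impI)
  fix x r assume "x \<in> A'" "0 < r \<and> r \<le> r\<^sub>0"
  have "unilateral_beta n \<S> A' x r \<le> unilateral_beta n \<S> A x r"
    unfolding unilateral_beta_def excess_def using assms(2)
    by (intro INF_mono' divide_right_mono_ennreal SUP_subset_mono) auto
  also have "\<dots> \<le> ennreal \<epsilon>"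
    using assms \<open>x \<in> A'\<close> \<open>0 < r \<and> r \<le> r\<^sub>0\<close> unfolding unilaterally_approximable_def by blast
  finally show "unilateral_beta n \<S> A' x r \<le> ennreal \<epsilon>" .
qed

text \<open>
  The infima over \<open>\<S>\<close> and over \<open>x + S\<close> need not be attained; any slack \<open>\<epsilon>' > \<epsilon>\<close>
  gives one \<open>S\<close> that serves all points of the ball.
\<close>

lemma approximable_piece_near:
  assumes app: "unilaterally_approximable n \<S> \<epsilon> r\<^sub>0 A"
    and x: "x \<in> A" and r: "0 < r" "r \<le> r\<^sub>0" and \<epsilon>: "0 < \<epsilon>" "\<epsilon> < \<epsilon>'"
  obtains S where "S \<in> \<S>"
    "\<And>a. a \<in> A \<inter> ecball n x r \<Longrightarrow> \<exists>v\<in>S. edist n a (\<lambda>i. x i + v i) < \<epsilon>' * r"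
proof -
  have "unilateral_beta n \<S> A x r \<le> ennreal \<epsilon>"
    using app x r unfolding unilaterally_approximable_def by blast
  also have "\<dots> < ennreal \<epsilon>'" using \<epsilon> by (simp add: ennreal_lessI)
  finally obtain S where S: "S \<in> \<S>"
      "excess n (A \<inter> ecball n x r) (translate_set x S) / ennreal r < ennreal \<epsilon>'"
    unfolding unilateral_beta_def INF_less_iff by blast
  have less: "excess n (A \<inter> ecball n x r) (translate_set x S) < ennreal (\<epsilon>' * r)"
    using S(2) r(1) \<epsilon> by (simp add: divide_less_ennreal ennreal_mult)
  show thesis
  proof (rule that[OF S(1)])
    fix a assume "a \<in> A \<inter> ecball n x r"
    then have "(INF b\<in>translate_set x S. ennreal (edist n a b))
        \<le> excess n (A \<inter> ecball n x r) (translate_set x S)"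
      unfolding excess_def by (rule SUP_upper)
    with less have "(INF b\<in>translate_set x S. ennreal (edist n a b)) < ennreal (\<epsilon>' * r)"
      by (rule order.strict_trans1[rotated])
    then show "\<exists>v\<in>S. edist n a (\<lambda>i. x i + v i) < \<epsilon>' * r"
      unfolding INF_less_iff translate_set_def
      using edist_nonneg by (auto simp: ennreal_less_iff)
  qed
qed

text \<open>
  Points of \<open>A\<close> in the ball are \<open>2\<epsilon>r\<close>-close to \<open>x + S\<close>, and only the part of \<open>S\<close> in the ball
  of radius \<open>r + 2\<epsilon>r \<le> 2r\<close> matters. The profile covers that part at scale \<open>\<epsilon> (2r)\<close>, so
  each of these points of \<open>A\<close> is \<open>4\<epsilon>r\<close>-close to a translated centre; recentring doubles this to \<open>8\<epsilon>r\<close>.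
\<close>

lemma approximable_piece_net:
  assumes prof: "covering_profile n \<S> \<alpha> C s\<^sub>0"
    and cls: "local_approximation_class n \<S>"
    and app: "unilaterally_approximable n \<S> \<epsilon> r\<^sub>0 A"
    and A: "A \<subseteq> Rn n" and x: "x \<in> A" and r: "0 < r" "r \<le> r\<^sub>0"
    and \<epsilon>: "0 < \<epsilon>" "\<epsilon> \<le> s\<^sub>0" "\<epsilon> \<le> 1 / 2"
  shows "\<exists>F. ball_net n (A \<inter> ecball n x r) (8 * \<epsilon> * r) F
    \<and> real (card F) \<le> C * \<epsilon> powr (- \<alpha>)"
proof -
  have "\<epsilon> < 2 * \<epsilon>" using \<epsilon> by simp
  from approximable_piece_near[OF app x r \<epsilon>(1) this] obtain S where S: "S \<in> \<S>"
    and near: "\<And>a. a \<in> A \<inter> ecball n x r \<Longrightarrow>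
      \<exists>v\<in>S. edist n a (\<lambda>i. x i + v i) < 2 * \<epsilon> * r" by blast
  have SR: "S \<subseteq> Rn n"
    using cls S closedin_subset unfolding local_approximation_class_def by blast
  have "0 < 2 * r" using r by simp
  then have "ereal_of_enat (covering_number n (S \<inter> ecball n origin (2 * r)) (\<epsilon> * (2 * r)))
      \<le> ereal (C * \<epsilon> powr (- \<alpha>))"
    using prof S \<epsilon> unfolding covering_profile_def by blast
  then obtain G where G: "ball_net n (S \<inter> ecball n origin (2 * r)) (\<epsilon> * (2 * r)) G"
      "real (card G) \<le> C * \<epsilon> powr (- \<alpha>)"
    unfolding ereal_covering_number_le_iff by blast
  define P where "P = translate_set x G"
  have finG: "finite G" using G(1) by (simp add: ball_net_def)
  have P: "finite P" "card P \<le> card G"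
    using finG card_image_le[OF finG] unfolding P_def translate_set_def by auto
  have "\<exists>p\<in>P. edist n a p \<le> 4 * \<epsilon> * r" if a: "a \<in> A \<inter> ecball n x r" for a
  proof -
    from near[OF a] obtain v where v: "v \<in> S" "edist n a (\<lambda>i. x i + v i) < 2 * \<epsilon> * r" by blast
    have "edist n origin v = edist n (\<lambda>i. x i + origin i) (\<lambda>i. x i + v i)"
      by (simp only: edist_translate)
    also have "\<dots> \<le> edist n x a + edist n a (\<lambda>i. x i + v i)"
      using edist_triangle[of n x "\<lambda>i. x i + v i" a] by simp
    also have "\<dots> \<le> r + 2 * \<epsilon> * r"
      using a v(2) by (auto simp: mem_ecball)
    also have "\<dots> \<le> 2 * r"
      using mult_right_mono[of "2 * \<epsilon>" 1 r] \<epsilon> r by simp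
    finally have "v \<in> S \<inter> ecball n origin (2 * r)"
      using v(1) SR unfolding Int_iff mem_ecball
      by (auto simp: topspace_Euclidean_space)
    then obtain g where g: "g \<in> G" "v \<in> ecball n g (\<epsilon> * (2 * r))"
      using G(1) unfolding ball_net_def by blast
    have "edist n a (\<lambda>i. x i + g i)
        \<le> edist n a (\<lambda>i. x i + v i) + edist n (\<lambda>i. x i + v i) (\<lambda>i. x i + g i)"
      by (rule edist_triangle)
    also have "\<dots> \<le> 2 * \<epsilon> * r + 2 * \<epsilon> * r"
      using v(2) g(2) by (intro add_mono) (auto simp: edist_translate mem_ecball edist_commute)
    finally have "edist n a (\<lambda>i. x i + g i) \<le> 4 * \<epsilon> * r" by simp
    then show ?thesis
      using g(1) unfolding P_def translate_set_def by blast
  qed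
  moreover have "A \<inter> ecball n x r \<subseteq> Rn n" using A by blast
  ultimately obtain F where F: "ball_net n (A \<inter> ecball n x r) (2 * (4 * \<epsilon> * r)) F"
      "card F \<le> card P"
    using ball_net_recentre[OF _ P(1), of "A \<inter> ecball n x r" n "4 * \<epsilon> * r"] by blast
  have "2 * (4 * \<epsilon> * r) = 8 * \<epsilon> * r" by simp
  with F P(2) G(2) show ?thesis by (intro exI[of _ F]) auto
qed

lemma iterated_net:
  assumes start: "ball_net n A r\<^sub>0 F\<^sub>0" and \<theta>: "0 < \<theta>" "\<theta> \<le> 1" and r\<^sub>0: "0 < r\<^sub>0"
    and refine: "\<And>x r. \<lbrakk>x \<in> A; 0 < r; r \<le> r\<^sub>0\<rbrakk> \<Longrightarrow>
      \<exists>F. ball_net n (A \<inter> ecball n x r) (\<theta> * r) F \<and> real (card F) \<le> M"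
  shows "\<exists>F. ball_net n A (\<theta> ^ m * r\<^sub>0) F \<and> real (card F) \<le> real (card F\<^sub>0) * M ^ m"
proof (induction m)
  case 0
  show ?case using start by (intro exI[of _ F\<^sub>0]) simp
next
  case (Suc m)
  let ?r = "\<theta> ^ m * r\<^sub>0"
  from Suc obtain F where F: "ball_net n A ?r F" "real (card F) \<le> real (card F\<^sub>0) * M ^ m"
    by blast
  have r: "0 < ?r" "?r \<le> r\<^sub>0"
    using \<theta> r\<^sub>0 by (auto simp: power_le_one mult_left_le_one_le)
  have FA: "F \<subseteq> A" "finite F" using F(1) by (auto simp: ball_net_def)
  then have "\<forall>x\<in>F. \<exists>G. ball_net n (A \<inter> ecball n x ?r) (\<theta> * ?r) G \<and> real (card G) \<le> M"
    using refine r by blast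
  then obtain G where G: "\<And>x. x \<in> F \<Longrightarrow> ball_net n (A \<inter> ecball n x ?r) (\<theta> * ?r) (G x)"
      "\<And>x. x \<in> F \<Longrightarrow> real (card (G x)) \<le> M" by metis
  show ?case
  proof (intro exI conjI)
    have "A \<subseteq> (\<Union>y\<in>(\<Union>x\<in>F. G x). ecball n y (\<theta> * ?r))"
    proof
      fix a assume "a \<in> A"
      with F(1) obtain x where x: "x \<in> F" "a \<in> A \<inter> ecball n x ?r"
        unfolding ball_net_def by blast
      with G(1)[OF x(1)] show "a \<in> (\<Union>y\<in>(\<Union>x\<in>F. G x). ecball n y (\<theta> * ?r))"
        unfolding ball_net_def by blast
    qed
    moreover have "finite (\<Union>x\<in>F. G x)" "(\<Union>x\<in>F. G x) \<subseteq> A"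
      using G(1) FA unfolding ball_net_def by blast+
    ultimately show "ball_net n A (\<theta> ^ Suc m * r\<^sub>0) (\<Union>x\<in>F. G x)"
      unfolding ball_net_def by (simp add: mult.assoc)
    have "real (card (\<Union>x\<in>F. G x)) \<le> (\<Sum>x\<in>F. real (card (G x)))"
      using card_UN_le[OF FA(2), of G] by (metis of_nat_mono of_nat_sum)
    also have "\<dots> \<le> (\<Sum>x\<in>F. M)" by (rule sum_mono) (rule G(2))
    also have "\<dots> = real (card F) * M" by simp
    also have "\<dots> \<le> real (card F\<^sub>0) * M ^ m * M"
    proof (cases "F = {}")
      case True
      then have "A = {}" using F(1) by (auto simp: ball_net_def)
      with start have "F\<^sub>0 = {}" by (simp add: ball_net_def)
      with True show ?thesis by simp
    next
      case False
      then obtain x where "x \<in> F" by blast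
      then have "0 \<le> M" using G(2)[of x] by (meson of_nat_0_le_iff order_trans)
      with F(2) show ?thesis by (rule mult_right_mono)
    qed
    finally show "real (card (\<Union>x\<in>F. G x)) \<le> real (card F\<^sub>0) * M ^ Suc m"
      by (simp add: mult_ac)
  qed
qed

text \<open>
  With \<open>d = ln M / ln (1/\<theta>)\<close> the growth factor is \<open>M = \<theta>\<^bsup>-d\<^esup>\<close>, so \<open>M\<^sup>m\<close> balls of radius
  \<open>\<theta>\<^sup>m r\<^sub>0\<close> have growth exponent \<open>d\<close>. A scale \<open>s\<close> between two consecutive
  powers costs at most one further factor \<open>M\<close>.
\<close>

lemma self_refining_dim_le:
  assumes A: "ebounded n A" and \<theta>: "0 < \<theta>" "\<theta> < 1" and r\<^sub>0: "0 < r\<^sub>0" and M: "1 \<le> M"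
    and refine: "\<And>x r. \<lbrakk>x \<in> A; 0 < r; r \<le> r\<^sub>0\<rbrakk> \<Longrightarrow>
      \<exists>F. ball_net n (A \<inter> ecball n x r) (\<theta> * r) F \<and> real (card F) \<le> M"
  shows "bounded_upper_Minkowski_dim n A \<le> ereal (ln M / ln (1 / \<theta>))"
proof -
  define d where "d = ln M / ln (1 / \<theta>)"
  have ln\<theta>: "0 < ln (1 / \<theta>)" using \<theta> by (simp add: ln_div)
  have d: "0 \<le> d" using M ln\<theta> by (simp add: d_def)
  have M_eq: "M = \<theta> powr (- d)"
  proof -
    have "- d * ln \<theta> = ln M" using ln\<theta> \<theta> by (simp add: d_def ln_div)
    then show ?thesis using \<theta> M by (simp add: powr_def)
  qed
  obtain F\<^sub>0 where F\<^sub>0: "ball_net n A r\<^sub>0 F\<^sub>0"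
    using bounded_ball_net[OF A r\<^sub>0] by blast
  define K where "K = real (card F\<^sub>0) + 1"
  have K: "0 < K" "real (card F\<^sub>0) \<le> K" by (auto simp: K_def)
  have "bounded_upper_Minkowski_dim n A \<le> ereal d"
  proof (rule bounded_upper_Minkowski_dim_leI)
    show "0 < K * (\<theta> / r\<^sub>0) powr (- d)" using K \<theta> r\<^sub>0 by simp
    have "\<forall>\<^sub>F s in at_right (0::real). 0 < s \<and> s < r\<^sub>0"
      unfolding eventually_at_right_field using r\<^sub>0 by (intro exI[of _ r\<^sub>0]) auto
    then show "\<forall>\<^sub>F s in at_right 0. ereal_of_enat (covering_number n A s)
        \<le> ereal (K * (\<theta> / r\<^sub>0) powr (- d) * s powr (- d))"
    proof eventually_elim
      case (elim s)
      have "\<exists>m. \<theta> ^ m * r\<^sub>0 \<le> s"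
      proof -
        obtain m where "\<theta> ^ m < s / r\<^sub>0"
          using real_arch_pow_inv[of "s / r\<^sub>0" \<theta>] elim r\<^sub>0 \<theta> by auto
        then show ?thesis using r\<^sub>0 by (intro exI[of _ m]) (simp add: field_simps)
      qed
      then obtain m where m: "\<theta> ^ m * r\<^sub>0 \<le> s" "\<And>j. j < m \<Longrightarrow> s < \<theta> ^ j * r\<^sub>0"
        using exists_least_iff[of "\<lambda>m. \<theta> ^ m * r\<^sub>0 \<le> s"] by (auto simp: not_le)
      then obtain j where j: "m = Suc j" using elim by (cases m) auto
      have "s < \<theta> ^ j * r\<^sub>0" using m(2) j by simp
      then have low: "\<theta> / r\<^sub>0 * s \<le> \<theta> ^ m"
        using \<theta> r\<^sub>0 j by (simp add: field_simps)
      have "M ^ m = (\<theta> ^ m) powr (- d)"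
        unfolding M_eq using \<theta> by (simp add: powr_realpow[symmetric] powr_powr mult.commute)
      also have "\<dots> \<le> (\<theta> / r\<^sub>0 * s) powr (- d)"
        using low \<theta> r\<^sub>0 elim d by (intro powr_mono2') auto
      also have "\<dots> = (\<theta> / r\<^sub>0) powr (- d) * s powr (- d)"
        using \<theta> r\<^sub>0 elim by (intro powr_mult)
      finally have Mm: "M ^ m \<le> (\<theta> / r\<^sub>0) powr (- d) * s powr (- d)" .
      obtain F where F: "ball_net n A (\<theta> ^ m * r\<^sub>0) F"
          "real (card F) \<le> real (card F\<^sub>0) * M ^ m"
        using iterated_net[OF F\<^sub>0 \<theta>(1) less_imp_le[OF \<theta>(2)] r\<^sub>0 refine] by blast
      have "ball_net n A s F"
        using F(1) m(1) unfolding ball_net_def by (fastforce simp: mem_ecball)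
      moreover have "real (card F) \<le> K * (\<theta> / r\<^sub>0) powr (- d) * s powr (- d)"
      proof -
        note F(2)
        also have "real (card F\<^sub>0) * M ^ m \<le> K * ((\<theta> / r\<^sub>0) powr (- d) * s powr (- d))"
          using K Mm M by (intro mult_mono) auto
        finally show ?thesis by (simp add: mult.assoc)
      qed
      ultimately show ?case
        unfolding ereal_covering_number_le_iff by blast
    qed
  qed
  then show ?thesis by (simp add: d_def)
qed

section \<open>The dimension bound\<close>

lemma bounded_approximable_dim_le:
  assumes prof: "covering_profile n \<S> \<alpha> C s\<^sub>0"
    and cls: "local_approximation_class n \<S>"
    and app: "unilaterally_approximable n \<S> \<epsilon> r\<^sub>0 A"
    and A: "A \<subseteq> Rn n" "ebounded n A" and r\<^sub>0: "0 < r\<^sub>0"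
    and \<epsilon>: "0 < \<epsilon>" "\<epsilon> \<le> s\<^sub>0" "\<epsilon> \<le> 1 / 64" and "0 < \<alpha>" "0 < C"
  shows "bounded_upper_Minkowski_dim n A
    \<le> ereal (\<alpha> + 2 * (\<bar>ln C\<bar> + \<alpha> * ln 8) / ln (1 / \<epsilon>))"
proof (cases "A = {}")
  case True
  have "ebounded n {}"
    using A(2) True by simp
  then have "bounded_upper_Minkowski_dim n A = -\<infinity>"
    using upper_Minkowski_dim_empty[of n] True by (simp add: upper_Minkowski_dim_def)
  then show ?thesis by simp
next
  case False
  then obtain x where x: "x \<in> A" by blast
  define M where "M = C * \<epsilon> powr (- \<alpha>)"
  define L where "L = ln (1 / \<epsilon>)"
  have refine: "\<exists>F. ball_net n (A \<inter> ecball n x r) (8 * \<epsilon> * r) F \<and> real (card F) \<le> M"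
    if "x \<in> A" "0 < r" "r \<le> r\<^sub>0" for x r
    unfolding M_def using that \<epsilon>
    by (intro approximable_piece_net[OF prof cls app A(1)]) auto
  \<comment> \<open>The piece of \<open>A\<close> around \<open>x\<close> contains \<open>x\<close>, so covering it takes at least one ball.\<close>
  have M: "1 \<le> M"
  proof -
    obtain F where F: "ball_net n (A \<inter> ecball n x r\<^sub>0) (8 * \<epsilon> * r\<^sub>0) F" "real (card F) \<le> M"
      using refine[OF x r\<^sub>0 order_refl] by blast
    have "x \<in> A \<inter> ecball n x r\<^sub>0"
      using x A(1) r\<^sub>0 by (auto simp: mem_ecball edist_def L2_set_def)
    with F(1) have "F \<noteq> {}" "finite F" unfolding ball_net_def by blast+
    then have "1 \<le> card F" by (simp add: Suc_leI card_gt_0_iff)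
    then have "1 \<le> real (card F)" by simp
    with F(2) show ?thesis by (rule order_trans[rotated])
  qed
  have dim: "bounded_upper_Minkowski_dim n A \<le> ereal (ln M / ln (1 / (8 * \<epsilon>)))"
    by (rule self_refining_dim_le[OF A(2) _ _ r\<^sub>0 M refine]) (use \<epsilon> in auto)
  have "ln (64::real) \<le> L"
    unfolding L_def using \<epsilon> by (subst ln_le_cancel_iff) (auto simp: field_simps)
  moreover have "ln (64::real) = 2 * ln 8"
    using ln_realpow[of "8::real" 2] by simp
  moreover have "0 < ln (8::real)" by simp
  ultimately have half: "0 < L" "L / 2 \<le> L - ln 8" by linarith+
  have lnM: "ln M = ln C + \<alpha> * L"
    using \<epsilon>(1) \<open>0 < C\<close> by (simp add: M_def L_def ln_mult ln_powr ln_div)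
  have "ln M / ln (1 / (8 * \<epsilon>)) = (ln C + \<alpha> * L) / (L - ln 8)"
    using \<epsilon>(1) by (simp add: lnM) (simp add: L_def ln_div ln_mult)
  also have "\<dots> = \<alpha> + (ln C + \<alpha> * ln 8) / (L - ln 8)"
    using half by (simp add: field_simps)
  also have "\<dots> \<le> \<alpha> + (\<bar>ln C\<bar> + \<alpha> * ln 8) / (L - ln 8)"
    using half by (intro add_left_mono divide_right_mono add_right_mono) auto
  also have "\<dots> \<le> \<alpha> + (\<bar>ln C\<bar> + \<alpha> * ln 8) / (L / 2)"
    using half \<open>0 < \<alpha>\<close> by (intro add_left_mono divide_left_mono add_nonneg_nonneg) auto
  also have "\<dots> = \<alpha> + 2 * (\<bar>ln C\<bar> + \<alpha> * ln 8) / L" by simp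
  finally show ?thesis
    using dim by (simp add: L_def order_trans)
qed

theorem theorem8p6:
  fixes \<alpha> C s\<^sub>0 :: real
  assumes "\<alpha> > 0" and "C > 0" and "0 < s\<^sub>0" and "s\<^sub>0 \<le> 1"
  shows "\<exists>\<epsilon>\<^sub>0>0. \<exists>C'>0.
    \<forall>(n::nat) (\<S> :: (nat \<Rightarrow> real) set set) (A :: (nat \<Rightarrow> real) set) (\<epsilon>::real) (r\<^sub>0::real).
      local_approximation_class n \<S> \<longrightarrow>
      covering_profile n \<S> \<alpha> C s\<^sub>0 \<longrightarrow>
      A \<subseteq> Rn n \<longrightarrow>
      0 < \<epsilon> \<longrightarrow> \<epsilon> \<le> \<epsilon>\<^sub>0 \<longrightarrow> 0 < r\<^sub>0 \<longrightarrow>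
      unilaterally_approximable n \<S> \<epsilon> r\<^sub>0 A \<longrightarrow>
      upper_Minkowski_dim n A \<le> ereal (\<alpha> + C' / ln (1 / \<epsilon>))"
proof (intro exI conjI allI impI)
  show "0 < min s\<^sub>0 (1 / 64)" using assms by simp
  show "0 < 2 * (\<bar>ln C\<bar> + \<alpha> * ln 8)"
    using assms by (simp add: add_nonneg_pos)
  fix n \<S> A \<epsilon> r\<^sub>0
  assume cls: "local_approximation_class n \<S>" and prof: "covering_profile n \<S> \<alpha> C s\<^sub>0"
    and A: "A \<subseteq> Rn n" and \<epsilon>: "0 < \<epsilon>" "\<epsilon> \<le> min s\<^sub>0 (1 / 64)" and r\<^sub>0: "0 < r\<^sub>0"
    and app: "unilaterally_approximable n \<S> \<epsilon> r\<^sub>0 A"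
  show "upper_Minkowski_dim n A \<le> ereal (\<alpha> + 2 * (\<bar>ln C\<bar> + \<alpha> * ln 8) / ln (1 / \<epsilon>))"
  proof (rule upper_Minkowski_dim_leI[OF A])
    fix A' assume A': "A' \<subseteq> A" "ebounded n A'"
    show "bounded_upper_Minkowski_dim n A'
        \<le> ereal (\<alpha> + 2 * (\<bar>ln C\<bar> + \<alpha> * ln 8) / ln (1 / \<epsilon>))"
      using A A' \<epsilon> assms r\<^sub>0
      by (intro bounded_approximable_dim_le[OF prof cls
            unilaterally_approximable_subset[OF app A'(1)]]) auto
  qed
qed

end
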